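(* There exists a smooth compensating matrix symbol $\widetilde K=\widetilde K(\xi)\in C^\infty(\mathbb R;\mathbb R^{3\times3})$ for the triplet $(I,\widetilde A(\xi),\widetilde B)$ of the context. In other words, $\widetilde K$ is skew-symmetric and $$[\widetilde K(\xi)\widetilde A(\xi)]^s+\widetilde B\ge\overline\gamma\,I>0$$ for some uniform constant $\overline\gamma>0$ independent of $\xi\in\mathbb R$. Moreover, $$|\xi\widetilde K(\xi)|,\ |\widetilde K(\xi)|\le C$$ for all $\xi\in\mathbb R$ and some uniform constant $C>0$.
   Context: $\overline\rho,\overline\theta,\overline p_\rho,\overline p_\theta,\overline e_\theta,\overline\mu,\overline\alpha,\overline k>0$ and $\overline u\in\mathbb R$ are constants (a constant state $(\overline\rho,\overline u,\overline\theta)$ and the values at it of derivatives of the pressure $p$ and internal energy $e$, the viscosity, heat conductivity and capillarity). Set $\beta(\xi):=\overline p_\rho+\xi^2\,\overline k\,\overline\rho$, $\ \overline c:=\overline p_\theta\,\overline\theta^{1/2}/(\overline e_\theta^{1/2}\,\overline\rho)>0$, $$\widetilde A(\xi)=\begin{pmatrix}\overline u&\beta(\xi)^{1/2}&0\\\beta(\xi)^{1/2}&\overline u&\overline c\\0&\overline c&\overline u\end{pmatrix},\qquad \widetilde B=\begin{pmatrix}0&0&0\\0&\overline\mu/\overline\rho&0\\0&0&\overline\alpha/(\overline e_\theta\overline\rho)\end{pmatrix}.$$ $I$ is the $3\times3$ identity, $[M]^s:=\frac12(M+M^\top)$ is the symmetric part of a real matrix $M$, and inequalities between symmetric matrices are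 in the sense of quadratic forms. *Compensating matrix symbol*: for smooth, symmetric real matrix-valued functions $A^0,A,B$ of $\xi\in\mathbb R$ with $A^0>0$, $B\ge0$, a smooth real matrix-valued function $K$ is a compensating matrix symbol for $(A^0,A,B)$ if $K(\xi)A^0(\xi)$ is skew-symmetric for all $\xi\in\mathbb R$ and $[K(\xi)A(\xi)]^s+B(\xi)\ge\gamma(\xi)I>0$ for all $\xi\ne0$ and some $\gamma(\xi)>0$. *)

theory Defs
  imports "HOL-Analysis.Analysis"
begin

definition smooth_curve :: "(real \<Rightarrow> 'a::real_normed_vector) \<Rightarrow> bool" where
  "smooth_curve f \<longleftrightarrow>
     (\<forall>n x. ((\<lambda>g t. vector_derivative g (at t)) ^^ n) f differentiable (at x))"

definition symmetric_matrix :: "real^'n^'n \<Rightarrow> bool" where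
  "symmetric_matrix M \<longleftrightarrow> transpose M = M"

definition skew_symmetric_matrix :: "real^'n^'n \<Rightarrow> bool" where
  "skew_symmetric_matrix M \<longleftrightarrow> transpose M = - M"

definition sym_part :: "real^'n^'n \<Rightarrow> real^'n^'n" where
  "sym_part M = (1/2) *\<^sub>R (M + transpose M)"

(* The order on symmetric matrices in the sense of quadratic forms; the order that
   real^'n^'n inherits from the class instances of vec is the entrywise one. *)
definition form_le :: "real^'n^'n \<Rightarrow> real^'n^'n \<Rightarrow> bool" where
  "form_le M N \<longleftrightarrow> symmetric_matrix M \<and> symmetric_matrix N \<and>
     (\<forall>x. x \<bullet> (M *v x) \<le> x \<bullet> (N *v x))"

definition form_less :: "real^'n^'n \<Rightarrow> real^'n^'n \<Rightarrow> bool" where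
  "form_less M N \<longleftrightarrow> symmetric_matrix M \<and> symmetric_matrix N \<and>
     (\<forall>x. x \<noteq> 0 \<longrightarrow> x \<bullet> (M *v x) < x \<bullet> (N *v x))"

(* The standing conditions on the triplet (smoothness, symmetry, A0 > 0, B >= 0) are
   part of the definition; symmetry of A0 and B is contained in form_less and form_le. *)
definition compensating_matrix_symbol ::
  "(real \<Rightarrow> real^'n^'n) \<Rightarrow> (real \<Rightarrow> real^'n^'n) \<Rightarrow> (real \<Rightarrow> real^'n^'n) \<Rightarrow>
   (real \<Rightarrow> real^'n^'n) \<Rightarrow> bool" where
  "compensating_matrix_symbol A0 A B K \<longleftrightarrow>
     smooth_curve A0 \<and> smooth_curve A \<and> smooth_curve B \<and>
     (\<forall>\<xi>. form_less 0 (A0 \<xi>) \<and> symmetric_matrix (A \<xi>) \<and> form_le 0 (B \<xi>)) \<and>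
     smooth_curve K \<and>
     (\<forall>\<xi>. skew_symmetric_matrix (K \<xi> ** A0 \<xi>)) \<and>
     (\<exists>\<gamma> :: real \<Rightarrow> real. \<forall>\<xi>. \<xi> \<noteq> 0 \<longrightarrow>
        \<gamma> \<xi> > 0 \<and> form_le (\<gamma> \<xi> *\<^sub>R mat 1) (sym_part (K \<xi> ** A \<xi>) + B \<xi>))"

definition beta :: "real \<Rightarrow> real \<Rightarrow> real \<Rightarrow> real \<Rightarrow> real" where
  "beta \<rho> p\<^sub>\<rho> k \<xi> = p\<^sub>\<rho> + \<xi>\<^sup>2 * k * \<rho>"

definition c_bar :: "real \<Rightarrow> real \<Rightarrow> real \<Rightarrow> real \<Rightarrow> real" where
  "c_bar \<rho> \<theta> p\<^sub>\<theta> e\<^sub>\<theta> = p\<^sub>\<theta> * sqrt \<theta> / (sqrt e\<^sub>\<theta> * \<rho>)"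

definition A_tilde ::
  "real \<Rightarrow> real \<Rightarrow> real \<Rightarrow> real \<Rightarrow> real \<Rightarrow> real \<Rightarrow> real \<Rightarrow> real \<Rightarrow> real^3^3" where
  "A_tilde \<rho> u \<theta> p\<^sub>\<rho> p\<^sub>\<theta> e\<^sub>\<theta> k \<xi> =
     (let b = sqrt (beta \<rho> p\<^sub>\<rho> k \<xi>); c = c_bar \<rho> \<theta> p\<^sub>\<theta> e\<^sub>\<theta> in
      vector [vector [u, b, 0],
              vector [b, u, c],
              vector [0, c, u]])"

definition B_tilde :: "real \<Rightarrow> real \<Rightarrow> real \<Rightarrow> real \<Rightarrow> real^3^3" where
  "B_tilde \<rho> e\<^sub>\<theta> \<mu> \<alpha> =
     vector [vector [0, 0, 0],
             vector [0, \<mu> / \<rho>, 0],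
             vector [0, 0, \<alpha> / (e\<^sub>\<theta> * \<rho>)]]"

end

theory Submission
  imports Defs "HOL-Computational_Algebra.Polynomial"
begin

text \<open>
  With \<open>b = sqrt \<beta>\<close> and \<open>J\<close> the generator of rotations in the first two coordinates, take
  \<open>K = (\<delta> / b) J\<close> for a small constant \<open>\<delta>\<close>. The factor \<open>1 / b\<close> cancels the growth of the
  off-diagonal entry of \<open>A\<close> and the contributions of \<open>u\<close> cancel, so that the quadratic form of
  \<open>K A\<close> is \<open>\<delta> (x\<^sub>1\<^sup>2 - x\<^sub>2\<^sup>2 + (c / b) x\<^sub>1 x\<^sub>3)\<close>. Since \<open>c / b\<close> is bounded, \<open>B\<close> absorbs the
  negative and mixed terms. Boundedness of \<open>\<xi> K\<close> holds because \<open>b\<close> grows linearly in \<open>\<bar>\<xi>\<bar>\<close>.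
\<close>

text \<open>A class closed under differentiation contains every iterated derivative of its members,
  so no formula for the n-th derivative is needed.\<close>

lemma smooth_curve_coinduct:
  assumes "P f"
    and step: "\<And>g. P g \<Longrightarrow> \<exists>g'. P g' \<and> (\<forall>x. (g has_vector_derivative g' x) (at x))"
  shows "smooth_curve f"
proof -
  let ?D = "\<lambda>g t. vector_derivative g (at t)"
  have D: "P (?D g)" if g: "P g" for g
  proof -
    obtain g' where g': "P g'" "\<And>x. (g has_vector_derivative g' x) (at x)"
      using step[OF g] by blast
    then have "?D g = g'"
      by (intro ext vector_derivative_at)
    with g' show ?thesis by simp
  qed
  have "P ((?D ^^ n) f)" for n
    by (induction n) (use assms(1) D in auto)
  then show ?thesis
    unfolding smooth_curve_def by (metis step differentiableI_vector)
qed

text \<open>The invariant class consists of constants plus \<open>p * g powr q\<close> times a fixed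
  \<open>M\<close>, with \<open>p\<close> a polynomial and \<open>q\<close> real. It is closed under
  differentiation because the derivative of \<open>p * g powr q\<close> is
  \<open>(p' * g + q * p * g') * g powr (q - 1)\<close>. The exponent 1/2 will serve
  \<open>A_tilde\<close>, and -1/2 the symbol \<open>K\<close>.\<close>

lemma smooth_curve_poly_powr:
  fixes C M :: "'a::real_normed_vector" and g :: "real poly"
  assumes pos: "\<And>x. poly g x > 0"
  shows "smooth_curve (\<lambda>x. C + (poly g x powr q) *\<^sub>R M)"
proof (rule smooth_curve_coinduct[where P =
      "\<lambda>f. \<exists>C p q. f = (\<lambda>x. C + (poly p x * poly g x powr q) *\<^sub>R M)"])
  show "\<exists>C' p q'. (\<lambda>x. C + (poly g x powr q) *\<^sub>R M) =
      (\<lambda>x. C' + (poly p x * poly g x powr q') *\<^sub>R M)"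
    by (intro exI[of _ C] exI[of _ 1] exI[of _ q]) simp
next
  fix f :: "real \<Rightarrow> 'a"
  assume "\<exists>C p q. f = (\<lambda>x. C + (poly p x * poly g x powr q) *\<^sub>R M)"
  then obtain C p q where f: "f = (\<lambda>x. C + (poly p x * poly g x powr q) *\<^sub>R M)"
    by blast
  define r where "r = pderiv p * g + smult q (p * pderiv g)"
  have "((\<lambda>x. poly p x * poly g x powr q) has_real_derivative
      poly r x * poly g x powr (q - 1)) (at x)" for x
  proof -
    have "poly g x powr q = poly g x * poly g x powr (q - 1)"
      using pos[of x] by (simp add: powr_diff)
    then have "poly r x * poly g x powr (q - 1) =
        poly (pderiv p) x * poly g x powr q +
        (q * poly g x powr (q - 1) * poly (pderiv g) x) * poly p x"
      by (simp add: r_def algebra_simps)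
    then show ?thesis
      using pos[of x] by (auto intro!: derivative_eq_intros)
  qed
  then have "(f has_vector_derivative 0 + (poly r x * poly g x powr (q - 1)) *\<^sub>R M) (at x)" for x
    unfolding f has_real_derivative_iff_has_vector_derivative
    by (intro has_vector_derivative_add has_vector_derivative_const
        bounded_linear.has_vector_derivative[OF bounded_linear_scaleR_left])
  then show "\<exists>f'. (\<exists>C p q. f' = (\<lambda>x. C + (poly p x * poly g x powr q) *\<^sub>R M)) \<and>
      (\<forall>x. (f has_vector_derivative f' x) (at x))"
    by blast
qed

lemma smooth_curve_const: "smooth_curve (\<lambda>x. C)"
  using smooth_curve_poly_powr[of 1 C 0 0] by simp

lemma symmetric_matrix_sym_part: "symmetric_matrix (sym_part M)"
  by (simp add: symmetric_matrix_def sym_part_def transpose_def vec_eq_iff add.commute)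

text \<open>A matrix and its transpose have the same quadratic form, so coercivity can be checked on
  \<open>K ** A\<close> itself.\<close>

lemma inner_sym_part: "x \<bullet> (sym_part M *v x) = x \<bullet> (M *v x)"
proof -
  have "x \<bullet> (transpose M *v x) = x \<bullet> (M *v x)"
    by (metis dot_lmul_matrix inner_commute transpose_matrix_vector)
  then show ?thesis
    by (simp add: sym_part_def scaleR_matrix_vector_assoc[symmetric]
        matrix_vector_mult_add_rdistrib inner_add_right)
qed

definition rotation_generator :: "real^3^3" where
  "rotation_generator = vector [vector [0, 1, 0], vector [-1, 0, 0], vector [0, 0, 0]]"

lemma skew_symmetric_rotation_generator:
  "skew_symmetric_matrix (t *\<^sub>R rotation_generator)"
  by (simp add: skew_symmetric_matrix_def rotation_generator_def transpose_def vec_eq_iff forall_3)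

lemma symmetric_A_tilde: "symmetric_matrix (A_tilde \<rho> u \<theta> p\<^sub>\<rho> p\<^sub>\<theta> e\<^sub>\<theta> k \<xi>)"
  by (simp add: symmetric_matrix_def A_tilde_def Let_def transpose_def vec_eq_iff forall_3)

lemma symmetric_B_tilde: "symmetric_matrix (B_tilde \<rho> e\<^sub>\<theta> \<mu> \<alpha>)"
  by (simp add: symmetric_matrix_def B_tilde_def transpose_def vec_eq_iff forall_3)

lemma inner_B_tilde:
  "x \<bullet> (B_tilde \<rho> e\<^sub>\<theta> \<mu> \<alpha> *v x) = \<mu> / \<rho> * (x$2)\<^sup>2 + \<alpha> / (e\<^sub>\<theta> * \<rho>) * (x$3)\<^sup>2"
  by (simp add: B_tilde_def inner_vec_def matrix_vector_mult_def sum_3 power2_eq_square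
      mult_ac)

text \<open>The first two rows of the generator times \<open>A_tilde\<close> are
  \<open>(b, u, c)\<close> and \<open>(-u, -b, 0)\<close>, and the third vanishes. The two
  \<open>u\<close> terms cancel in the quadratic form, and dividing by \<open>b\<close> makes the
  diagonal entries constant.\<close>

lemma inner_rotation_A_tilde:
  assumes "beta \<rho> p\<^sub>\<rho> k \<xi> > 0"
  shows "x \<bullet> ((\<delta> / sqrt (beta \<rho> p\<^sub>\<rho> k \<xi>)) *\<^sub>R rotation_generator
            ** A_tilde \<rho> u \<theta> p\<^sub>\<rho> p\<^sub>\<theta> e\<^sub>\<theta> k \<xi> *v x) =
    \<delta> * ((x$1)\<^sup>2 - (x$2)\<^sup>2 + c_bar \<rho> \<theta> p\<^sub>\<theta> e\<^sub>\<theta> / sqrt (beta \<rho> p\<^sub>\<rho> k \<xi>) * (x$1 * x$3))"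
proof -
  have "sqrt (beta \<rho> p\<^sub>\<rho> k \<xi>) \<noteq> 0"
    using assms by simp
  then show ?thesis
    by (simp add: rotation_generator_def A_tilde_def Let_def inner_vec_def matrix_vector_mult_def
        matrix_matrix_mult_def sum_3 power2_eq_square field_simps)
qed

text \<open>Expanding the square \<open>\<delta> / 2 * (x + t * z)\<^sup>2\<close> bounds the mixed
  term from below at the cost of half of \<open>\<delta> * x\<^sup>2\<close> and at most half of
  \<open>a * z\<^sup>2\<close>. The other halves remain, and \<open>y\<^sup>2\<close> keeps the
  coefficient \<open>m - \<delta>\<close>, which is at least \<open>\<delta>\<close>.\<close>

lemma quadratic_form_lower_bound:
  fixes \<delta> t m a x y z :: real
  assumes "0 \<le> \<delta>" "2 * \<delta> \<le> m" "\<delta> * t\<^sup>2 \<le> a"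
  shows "min \<delta> a / 2 * (x\<^sup>2 + y\<^sup>2 + z\<^sup>2) \<le> \<delta> * (x\<^sup>2 - y\<^sup>2 + t * (x * z)) + (m * y\<^sup>2 + a * z\<^sup>2)"
proof -
  have "min \<delta> a / 2 * x\<^sup>2 \<le> \<delta> / 2 * x\<^sup>2" "min \<delta> a / 2 * z\<^sup>2 \<le> a / 2 * z\<^sup>2"
    by (intro mult_right_mono; simp)+
  moreover have "min \<delta> a / 2 * y\<^sup>2 \<le> (m - \<delta>) * y\<^sup>2"
    using assms by (intro mult_right_mono) auto
  moreover have "\<delta> * t\<^sup>2 * z\<^sup>2 \<le> a * z\<^sup>2"
    using assms by (intro mult_right_mono) auto
  moreover have "0 \<le> \<delta> / 2 * (x + t * z)\<^sup>2"
    using assms by simp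
  ultimately show ?thesis
    unfolding power2_sum power_mult_distrib ring_distribs mult.assoc by (simp add: mult_ac)
qed

theorem lemma4p12:
  fixes \<rho> u \<theta> p\<^sub>\<rho> p\<^sub>\<theta> e\<^sub>\<theta> \<mu> \<alpha> k :: real
  assumes "\<rho> > 0" "\<theta> > 0" "p\<^sub>\<rho> > 0" "p\<^sub>\<theta> > 0" "e\<^sub>\<theta> > 0" "\<mu> > 0" "\<alpha> > 0" "k > 0"
  shows "\<exists>K :: real \<Rightarrow> real^3^3.
     compensating_matrix_symbol (\<lambda>\<xi>. mat 1) (A_tilde \<rho> u \<theta> p\<^sub>\<rho> p\<^sub>\<theta> e\<^sub>\<theta> k)
       (\<lambda>\<xi>. B_tilde \<rho> e\<^sub>\<theta> \<mu> \<alpha>) K \<and>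
     (\<forall>\<xi>. skew_symmetric_matrix (K \<xi>)) \<and>
     (\<exists>\<gamma>>0. \<forall>\<xi>. form_le (\<gamma> *\<^sub>R mat 1)
        (sym_part (K \<xi> ** A_tilde \<rho> u \<theta> p\<^sub>\<rho> p\<^sub>\<theta> e\<^sub>\<theta> k \<xi>) + B_tilde \<rho> e\<^sub>\<theta> \<mu> \<alpha>)) \<and>
     (\<exists>C>0. \<forall>\<xi>. norm (\<xi> *\<^sub>R K \<xi>) \<le> C \<and> norm (K \<xi>) \<le> C)"
proof -
  define b where "b = (\<lambda>\<xi>. sqrt (beta \<rho> p\<^sub>\<rho> k \<xi>))"
  define c where "c = c_bar \<rho> \<theta> p\<^sub>\<theta> e\<^sub>\<theta>"
  define m a where "m = \<mu> / \<rho>" and "a = \<alpha> / (e\<^sub>\<theta> * \<rho>)"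
  \<comment> \<open>The first bound leaves \<open>m - \<delta> \<ge> \<delta>\<close>. The second
    gives \<open>\<delta> * c\<^sup>2 \<le> a * p\<^sub>\<rho>\<close>, and its denominator is
    positive for any value of \<open>c\<close>.\<close>
  define \<delta> where "\<delta> = min (m / 2) (a * p\<^sub>\<rho> / (c\<^sup>2 + p\<^sub>\<rho>))"
  define K where "K = (\<lambda>\<xi>. (\<delta> / b \<xi>) *\<^sub>R rotation_generator)"
  define \<gamma> where "\<gamma> = min \<delta> a / 2"
  let ?A = "A_tilde \<rho> u \<theta> p\<^sub>\<rho> p\<^sub>\<theta> e\<^sub>\<theta> k"
  let ?B = "B_tilde \<rho> e\<^sub>\<theta> \<mu> \<alpha>"

  have m: "m > 0" and a: "a > 0"
    using assms by (simp_all add: m_def a_def)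
  have "c\<^sup>2 + p\<^sub>\<rho> > 0"
    using assms by (simp add: add_nonneg_pos)
  then have \<delta>: "\<delta> > 0" "2 * \<delta> \<le> m" "\<delta> * (c\<^sup>2 + p\<^sub>\<rho>) \<le> a * p\<^sub>\<rho>"
    using assms m a by (simp_all add: \<delta>_def flip: pos_le_divide_eq[of "c\<^sup>2 + p\<^sub>\<rho>"])
  have \<gamma>: "\<gamma> > 0"
    using \<delta> a by (simp add: \<gamma>_def)
  \<comment> \<open>Each bound drops one summand of \<open>beta\<close>. The constant bound controls
    \<open>c / b\<close> and \<open>K\<close>; the quadratic one controls
    \<open>\<xi> *\<^sub>R K \<xi>\<close>.\<close>
  have beta_ge: "p\<^sub>\<rho> \<le> beta \<rho> p\<^sub>\<rho> k \<xi>" "\<xi>\<^sup>2 * (k * \<rho>) \<le> beta \<rho> p\<^sub>\<rho> k \<xi>" for \<xi>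
    using assms by (simp_all add: beta_def)
  then have beta_pos: "beta \<rho> p\<^sub>\<rho> k \<xi> > 0" for \<xi>
    using assms(3) by (meson less_le_trans)
  then have b_pos: "b \<xi> > 0" for \<xi>
    by (simp add: b_def)
  have b_ge: "sqrt p\<^sub>\<rho> \<le> b \<xi>" "\<bar>\<xi>\<bar> * sqrt (k * \<rho>) \<le> b \<xi>" for \<xi>
    using real_sqrt_le_mono[OF beta_ge(1)] real_sqrt_le_mono[OF beta_ge(2)]
    by (simp_all add: b_def real_sqrt_mult)

  have coercive: "form_le (\<gamma> *\<^sub>R mat 1) (sym_part (K \<xi> ** ?A \<xi>) + ?B)" for \<xi>
    unfolding form_le_def
  proof (intro conjI allI)
    show "symmetric_matrix (\<gamma> *\<^sub>R mat 1 :: real^3^3)"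
      by (auto simp: symmetric_matrix_def transpose_def mat_def vec_eq_iff)
    show "symmetric_matrix (sym_part (K \<xi> ** ?A \<xi>) + ?B)"
      using symmetric_matrix_sym_part[of "K \<xi> ** ?A \<xi>"] symmetric_B_tilde[of \<rho> e\<^sub>\<theta> \<mu> \<alpha>]
      by (simp add: symmetric_matrix_def transpose_def vec_eq_iff)
    fix x :: "real^3"
    \<comment> \<open>This chain verifies the last hypothesis of
      \<open>quadratic_form_lower_bound\<close> for \<open>t = c / b \<xi>\<close>, uniformly in
      \<xi>.\<close>
    have "\<delta> * (c / b \<xi>)\<^sup>2 \<le> \<delta> * (c\<^sup>2 / p\<^sub>\<rho>)"
      using beta_ge(1)[of \<xi>] beta_pos[of \<xi>] assms \<delta>(1)
      by (intro mult_left_mono) (auto simp: b_def power_divide intro!: divide_left_mono)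
    also have "\<dots> \<le> a"
    proof -
      have "\<delta> * c\<^sup>2 \<le> a * p\<^sub>\<rho>"
        using \<delta>(3) mult_pos_pos[OF \<delta>(1) assms(3)] by (simp add: distrib_left)
      then show ?thesis
        using assms(3) by (simp add: field_simps)
    qed
    finally have "\<gamma> * ((x$1)\<^sup>2 + (x$2)\<^sup>2 + (x$3)\<^sup>2) \<le>
        \<delta> * ((x$1)\<^sup>2 - (x$2)\<^sup>2 + c / b \<xi> * (x$1 * x$3)) + (m * (x$2)\<^sup>2 + a * (x$3)\<^sup>2)"
      unfolding \<gamma>_def using \<delta> by (intro quadratic_form_lower_bound) auto
    also have "\<dots> = x \<bullet> ((sym_part (K \<xi> ** ?A \<xi>) + ?B) *v x)"
      unfolding matrix_vector_mult_add_rdistrib inner_add_right inner_sym_part inner_B_tilde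
        K_def b_def inner_rotation_A_tilde[OF beta_pos] m_def a_def c_def ..
    finally show "x \<bullet> (\<gamma> *\<^sub>R mat 1 *v x) \<le> x \<bullet> ((sym_part (K \<xi> ** ?A \<xi>) + ?B) *v x)"
      by (simp add: scaleR_matrix_vector_assoc[symmetric] inner_vec_def sum_3 power2_eq_square
          distrib_left mult.left_commute)
  qed

  \<comment> \<open>This is \<open>beta\<close> as a polynomial in \<xi>, so that \<open>b\<close>
    and \<open>1 / b\<close> become real powers of a positive polynomial.\<close>
  define g where "g = [:p\<^sub>\<rho>, 0, k * \<rho>:]"
  have g: "poly g \<xi> = beta \<rho> p\<^sub>\<rho> k \<xi>" for \<xi>
    by (simp add: g_def beta_def power2_eq_square algebra_simps)
  have g_pos: "poly g \<xi> > 0" for \<xi>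
    by (simp add: g beta_pos)
  have b_powr: "b \<xi> = poly g \<xi> powr (1 / 2)" "1 / b \<xi> = poly g \<xi> powr (- 1 / 2)" for \<xi>
    using g_pos[of \<xi>] by (simp_all add: b_def g powr_half_sqrt powr_minus_divide)
  have smooth_A: "smooth_curve ?A"
  proof -
    \<comment> \<open>Only the two entries equal to \<open>b\<close> depend on \<xi>; all others go
      into the constant summand.\<close>
    have "?A = (\<lambda>\<xi>. vector [vector [u, 0, 0], vector [0, u, c], vector [0, c, u]] +
        (poly g \<xi> powr (1 / 2)) *\<^sub>R
        (vector [vector [0, 1, 0], vector [1, 0, 0], vector [0, 0, 0]] :: real^3^3))"
      by (simp flip: b_powr add: b_def c_def A_tilde_def Let_def fun_eq_iff vec_eq_iff forall_3)
    then show ?thesis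
      by (simp only: smooth_curve_poly_powr[OF g_pos])
  qed
  have smooth_K: "smooth_curve K"
  proof -
    have "K = (\<lambda>\<xi>. 0 + (poly g \<xi> powr (- 1 / 2)) *\<^sub>R (\<delta> *\<^sub>R rotation_generator))"
      unfolding b_powr(2)[symmetric] by (simp add: K_def)
    then show ?thesis
      by (simp only: smooth_curve_poly_powr[OF g_pos])
  qed

  have skew: "skew_symmetric_matrix (K \<xi>)" for \<xi>
    unfolding K_def by (rule skew_symmetric_rotation_generator)
  have zero: "symmetric_matrix (0 :: real^3^3)"
    by (simp add: symmetric_matrix_def transpose_def vec_eq_iff)
  have "form_less 0 (mat 1 :: real^3^3)"
    using zero by (simp add: form_less_def symmetric_matrix_def)
  moreover have "form_le 0 ?B"
    using zero m a
    by (auto simp: form_le_def symmetric_B_tilde inner_B_tilde simp flip: m_def a_def)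
  \<comment> \<open>The uniform constant supplies the pointwise \<gamma> as a constant function, and
    skewness of \<open>K ** mat 1\<close> is that of \<open>K\<close>.\<close>
  ultimately have "compensating_matrix_symbol (\<lambda>\<xi>. mat 1) ?A (\<lambda>\<xi>. ?B) K"
    unfolding compensating_matrix_symbol_def
    using \<gamma> coercive skew smooth_A smooth_K
    by (auto simp: smooth_curve_const symmetric_A_tilde intro!: exI[of _ "\<lambda>_. \<gamma>"])
  moreover
  define N where "N = \<delta> * norm rotation_generator"
  \<comment> \<open>The two quotients bound \<open>K\<close> and
    \<open>\<xi> *\<^sub>R K \<xi>\<close> respectively; adding 1 makes \<open>C\<close> strictly
    positive using only \<open>N \<ge> 0\<close>.\<close>
  define C where "C = N / sqrt p\<^sub>\<rho> + N / sqrt (k * \<rho>) + 1"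
  have N: "N \<ge> 0"
    using \<delta>(1) by (simp add: N_def)
  have quotients: "0 \<le> N / sqrt p\<^sub>\<rho>" "0 \<le> N / sqrt (k * \<rho>)"
    using N assms by simp_all
  have norm_K: "norm (K \<xi>) = N / b \<xi>" for \<xi>
    using \<delta>(1) b_pos[of \<xi>] by (simp add: K_def N_def)
  have "norm (K \<xi>) \<le> C" for \<xi>
  proof -
    have "N / b \<xi> \<le> N / sqrt p\<^sub>\<rho>"
      using N b_ge(1)[of \<xi>] b_pos[of \<xi>] assms(3) by (intro divide_left_mono) auto
    then show ?thesis
      using quotients by (simp add: norm_K C_def)
  qed
  moreover have "norm (\<xi> *\<^sub>R K \<xi>) \<le> C" for \<xi>
  proof -
    have "sqrt (k * \<rho>) > 0"
      using assms by simp
    then have "\<bar>\<xi>\<bar> / b \<xi> \<le> 1 / sqrt (k * \<rho>)"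
      using b_ge(2)[of \<xi>] b_pos[of \<xi>] by (simp add: divide_le_eq le_divide_eq)
    from mult_left_mono[OF this N] show ?thesis
      using quotients by (simp add: norm_K C_def mult.commute)
  qed
  moreover have "C > 0"
    using quotients by (simp add: C_def)
  ultimately show ?thesis
    using \<gamma> coercive skew by blast
qed

end
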